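(* The following hold. (a) If $f,g\in\mathcal F_n$ are monotone subtypes with $O_f=O_g$, then $f\vee g$ and $f\wedge g$ are monotone as well. (b) Let $f\in\mathcal F_n$ and $g\in\mathcal F_m$ be monotone subtypes and let $\sigma$ be any permutation of $[n]$. Then $f\circ\sigma$, $f^*$, $f\vartriangleleft g$, $f\otimes g$ and $(f^*\otimes g^* )^*$ are monotone subtypes as well. (c) Any type function is monotone.
   Context: Notation. $[n]=\{1,\dots,n\}$; $\theta=\theta_n\in\{0,1\}^n$ is the zero string. $\mathcal F_n=\{f:\{0,1\}^n\to\{0,1\} : f(\theta)=1\}$ with pointwise order, $\vee,\wedge$ the pointwise maximum/minimum; $p_n$ is the indicator function of $\{\theta\}$, $1_n$ the constant function $1$, and $f^*=1-f+p_n$. For $T\subseteq[n]$, $p_T(s)=\prod_{i\in T}(1-s_i)$. For $f\in\mathcal F_n$, $g\in\mathcal F_m$ and strings $s=s^1s^2$ (concatenation, $s^1\in\{0,1\}^n$, $s^2\in\{0,1\}^m$): $(f\otimes g)(s)=f(s^1)g(s^2)$, and the causal product is $(f\vartriangleleft g)(s)=f(s^1)$ if $s^1\neq\theta_n$, $(f\vartriangleleft g)(s)=g(s^2)$ if $s^1=\theta_n$. A permutation $\sigma$ of $[n]$ acts on strings by $\sigma(s)=s_{\sigma^{-1}(1)}\dots s_{\sigma^{-1}(n)}$, and $f\circ\sigma$ is the composition. With $e^i_j=\delta_{i,j}$, put $I_f=\{i: f(e^i)=0\}$, $O_f=\{j: f(e^j)=1\}$. The sets $\mathcal T_n\subseteq\mathcal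 F_n$ ($n\ge1$) of type functions form the smallest family with $1_1\in\mathcal T_1$ closed under $f\mapsto f^*$, $f\mapsto f\circ\sigma$ (all permutations), and $(f,g)\mapsto f\otimes g$. $f\in\mathcal F_n$ is a subtype if $p_{I_f}\le f\le p_{O_f}^*$. For $O\subseteq[n]$, $s\le_Os'$ means $s_i\le s_i'$ for $i\in O$ and $s_i\ge s_i'$ for $i\notin O$. $f\in\mathcal F_n$ is monotone if $s\le_{O_f}s'$ implies $f(s)\le f(s')$. *)

theory Defs
  imports Complex_Main "HOL-Library.FuncSet" "HOL-Combinatorics.Permutations"
begin

text \<open>
  Positions in a string are counted from 0, as usual for lists, so the index set of a string of
  length n is \<open>{..<n}\<close>. Functions on strings of length n are extensional: they are \<open>undefined\<close>
  off \<open>strings n\<close>, so that equality of functions, the order \<open>\<le>\<close> and the lattice operations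
  \<open>sup\<close>, \<open>inf\<close> of the function type are exactly the pointwise notions on \<open>strings n\<close>.
\<close>

definition strings :: "nat \<Rightarrow> int list set" where
  "strings n = {s. set s \<subseteq> {0, 1} \<and> length s = n}"

definition zero_string :: "nat \<Rightarrow> int list" where
  "zero_string n = replicate n 0"

definition unit_string :: "nat \<Rightarrow> nat \<Rightarrow> int list" where
  "unit_string n i = map (\<lambda>j. if i = j then 1 else 0) [0..<n]"

definition bool_funs :: "nat \<Rightarrow> (int list \<Rightarrow> int) set" where
  "bool_funs n = {f \<in> strings n \<rightarrow>\<^sub>E {0, 1}. f (zero_string n) = 1}"

definition one_fun :: "nat \<Rightarrow> int list \<Rightarrow> int" where
  "one_fun n = (\<lambda>s\<in>strings n. 1)"

definition point_fun :: "nat \<Rightarrow> int list \<Rightarrow> int" where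
  "point_fun n = (\<lambda>s\<in>strings n. if s = zero_string n then 1 else 0)"

definition face_fun :: "nat \<Rightarrow> nat set \<Rightarrow> int list \<Rightarrow> int" where
  "face_fun n T = (\<lambda>s\<in>strings n. \<Prod>i\<in>T. 1 - s ! i)"

definition dual :: "nat \<Rightarrow> (int list \<Rightarrow> int) \<Rightarrow> int list \<Rightarrow> int" where
  "dual n f = (\<lambda>s\<in>strings n. 1 - f s + point_fun n s)"

definition tensor ::
  "nat \<Rightarrow> nat \<Rightarrow> (int list \<Rightarrow> int) \<Rightarrow> (int list \<Rightarrow> int) \<Rightarrow> int list \<Rightarrow> int" where
  "tensor n m f g = (\<lambda>s\<in>strings (n + m). f (take n s) * g (drop n s))"

definition causal ::
  "nat \<Rightarrow> nat \<Rightarrow> (int list \<Rightarrow> int) \<Rightarrow> (int list \<Rightarrow> int) \<Rightarrow> int list \<Rightarrow> int" where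
  "causal n m f g =
    (\<lambda>s\<in>strings (n + m). if take n s \<noteq> zero_string n then f (take n s) else g (drop n s))"

text \<open>
  The entry of \<open>permute_list p s\<close> at position i is \<open>s ! p i\<close>, hence the inverse: the action of
  \<open>\<sigma>\<close> sends s to the string whose entry at i is the entry of s at \<open>inv \<sigma> i\<close>.
\<close>

definition perm_string :: "(nat \<Rightarrow> nat) \<Rightarrow> int list \<Rightarrow> int list" where
  "perm_string \<sigma> s = permute_list (inv \<sigma>) s"

definition perm_fun :: "nat \<Rightarrow> (int list \<Rightarrow> int) \<Rightarrow> (nat \<Rightarrow> nat) \<Rightarrow> int list \<Rightarrow> int" where
  "perm_fun n f \<sigma> = compose (strings n) f (perm_string \<sigma>)"

definition in_indices :: "nat \<Rightarrow> (int list \<Rightarrow> int) \<Rightarrow> nat set" where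
  "in_indices n f = {i \<in> {..<n}. f (unit_string n i) = 0}"

definition out_indices :: "nat \<Rightarrow> (int list \<Rightarrow> int) \<Rightarrow> nat set" where
  "out_indices n f = {i \<in> {..<n}. f (unit_string n i) = 1}"

inductive type_fun :: "nat \<Rightarrow> (int list \<Rightarrow> int) \<Rightarrow> bool" where
  one: "type_fun 1 (one_fun 1)"
| dual: "type_fun n f \<Longrightarrow> type_fun n (dual n f)"
| perm: "type_fun n f \<Longrightarrow> \<sigma> permutes {..<n} \<Longrightarrow> type_fun n (perm_fun n f \<sigma>)"
| tensor: "type_fun n f \<Longrightarrow> type_fun m g \<Longrightarrow> type_fun (n + m) (tensor n m f g)"

definition subtype :: "nat \<Rightarrow> (int list \<Rightarrow> int) \<Rightarrow> bool" where
  "subtype n f \<longleftrightarrow>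
     f \<in> bool_funs n \<and>
     face_fun n (in_indices n f) \<le> f \<and> f \<le> dual n (face_fun n (out_indices n f))"

definition string_le :: "nat \<Rightarrow> nat set \<Rightarrow> int list \<Rightarrow> int list \<Rightarrow> bool" where
  "string_le n A s s' \<longleftrightarrow>
     (\<forall>i\<in>{..<n} \<inter> A. s ! i \<le> s' ! i) \<and> (\<forall>i\<in>{..<n} - A. s ! i \<ge> s' ! i)"

definition monotone_fun :: "nat \<Rightarrow> (int list \<Rightarrow> int) \<Rightarrow> bool" where
  "monotone_fun n f \<longleftrightarrow>
     f \<in> bool_funs n \<and>
     (\<forall>s\<in>strings n. \<forall>s'\<in>strings n. string_le n (out_indices n f) s s' \<longrightarrow> f s \<le> f s')"

definition monotone_subtype :: "nat \<Rightarrow> (int list \<Rightarrow> int) \<Rightarrow> bool" where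
  "monotone_subtype n f \<longleftrightarrow> subtype n f \<and> monotone_fun n f"

end

theory Submission
  imports Defs
begin

text \<open>
  Every monotone function is a subtype: a string vanishing on the input indices lies above the
  zero string, and a nonzero string vanishing on the output indices lies below the unit string of
  one of its support points. Hence only monotonicity has to be propagated. The two inequalities
  defining a subtype are exactly what settles the comparisons with the zero string, where the dual
  and the causal product change their formula.
\<close>

section \<open>Zero and unit strings, and splitting a string into two blocks\<close>

lemma zero_string_in_strings [simp]: "zero_string n \<in> strings n"
  by (auto simp: strings_def zero_string_def)

lemma unit_string_in_strings [simp]: "unit_string n i \<in> strings n"
  by (auto simp: strings_def unit_string_def)

lemma length_strings: "s \<in> strings n \<Longrightarrow> length s = n"
  by (simp add: strings_def)

lemma nth_strings: "s \<in> strings n \<Longrightarrow> i < n \<Longrightarrow> s ! i = 0 \<or> s ! i = 1"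
  by (auto simp: strings_def dest!: nth_mem)

lemma nth_zero_string [simp]: "i < n \<Longrightarrow> zero_string n ! i = 0"
  by (simp add: zero_string_def)

lemma nth_unit_string [simp]: "j < n \<Longrightarrow> unit_string n i ! j = (if i = j then 1 else 0)"
  by (simp add: unit_string_def)

lemma eq_zero_string_iff: "s \<in> strings n \<Longrightarrow> s = zero_string n \<longleftrightarrow> (\<forall>i<n. s ! i = 0)"
  by (auto simp: list_eq_iff_nth_eq length_strings[of s] length_strings[OF zero_string_in_strings])

lemma unit_string_neq_zero_string: "i < n \<Longrightarrow> unit_string n i \<noteq> zero_string n"
  by (auto simp: eq_zero_string_iff)

lemma take_in_strings: "s \<in> strings (n + m) \<Longrightarrow> take n s \<in> strings n"
  by (auto simp: strings_def dest: in_set_takeD)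

lemma drop_in_strings: "s \<in> strings (n + m) \<Longrightarrow> drop n s \<in> strings m"
  by (auto simp: strings_def dest: in_set_dropD)

lemma take_drop_zero_string [simp]:
  "take n (zero_string (n + m)) = zero_string n"
  "drop n (zero_string (n + m)) = zero_string m"
  by (auto simp: zero_string_def)

lemma take_unit_string:
  "take n (unit_string (n + m) i) = (if i < n then unit_string n i else zero_string n)"
  by (rule nth_equalityI) (auto simp: unit_string_def zero_string_def)

lemma drop_unit_string:
  "drop n (unit_string (n + m) i) = (if i < n then zero_string m else unit_string m (i - n))"
  by (rule nth_equalityI) (auto simp: unit_string_def zero_string_def)

section \<open>Boolean functions and the monotonicity condition\<close>

lemma bool_funsI:
  assumes "f \<in> extensional (strings n)" "f (zero_string n) = 1"
    and "\<And>s. s \<in> strings n \<Longrightarrow> f s = 0 \<or> f s = 1"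
  shows "f \<in> bool_funs n"
  using assms by (auto simp: bool_funs_def PiE_def)

lemma bool_funsD:
  assumes "f \<in> bool_funs n"
  shows "f \<in> extensional (strings n)" "f (zero_string n) = 1"
    and "s \<in> strings n \<Longrightarrow> f s = 0 \<or> f s = 1"
  using assms by (auto simp: bool_funs_def PiE_def Pi_def)

text \<open>Since values are 0 or 1, an inequality between two of them is an implication between
  being 1. All closure proofs below use this form.\<close>

lemma monotone_fun_iff:
  "monotone_fun n f \<longleftrightarrow> f \<in> bool_funs n \<and>
     (\<forall>s\<in>strings n. \<forall>s'\<in>strings n. string_le n (out_indices n f) s s' \<longrightarrow> f s = 1 \<longrightarrow> f s' = 1)"
proof -
  have "f s \<le> f s' \<longleftrightarrow> (f s = 1 \<longrightarrow> f s' = 1)"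
    if "f \<in> bool_funs n" "s \<in> strings n" "s' \<in> strings n" for s s'
    using bool_funsD(3)[OF that(1,2)] bool_funsD(3)[OF that(1,3)] by auto
  then show ?thesis
    unfolding monotone_fun_def by (intro conj_cong refl ball_cong imp_cong) auto
qed

text \<open>The index set \<open>A\<close> is a separate parameter so that the output indices of a
  compound function are computed once and then enter the order in explicit form.\<close>

lemma monotone_funI:
  assumes "f \<in> bool_funs n" "out_indices n f = A"
    and "\<And>s s'. s \<in> strings n \<Longrightarrow> s' \<in> strings n \<Longrightarrow> string_le n A s s' \<Longrightarrow> f s = 1 \<Longrightarrow> f s' = 1"
  shows "monotone_fun n f"
  using assms unfolding monotone_fun_iff by blast

lemma monotone_funD:
  assumes "monotone_fun n f" "s \<in> strings n" "s' \<in> strings n"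
    and "string_le n (out_indices n f) s s'" "f s = 1"
  shows "f s' = 1"
  using assms unfolding monotone_fun_iff by blast

section \<open>Output indices and comparisons with the zero string\<close>

lemma out_indices_subset: "out_indices n f \<subseteq> {..<n}"
  by (auto simp: out_indices_def)

text \<open>The strings above the zero string are those supported on the output indices, so this is
  the lower subtype bound in order form. It follows from \<open>f\<close> being 1 at the zero
  string.\<close>

lemma monotone_fun_above_zero:
  assumes "monotone_fun n f" "s \<in> strings n"
    and "string_le n (out_indices n f) (zero_string n) s"
  shows "f s = 1"
proof (rule monotone_funD[OF assms(1) zero_string_in_strings assms(2,3)])
  show "f (zero_string n) = 1"
    using assms(1) bool_funsD(2) unfolding monotone_fun_def by blast
qed

text \<open>The strings below the zero string are those supported off the output indices, so this is
  the upper subtype bound in order form. Such a nonzero string is squeezed below a unit string on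
  which \<open>f\<close> is 0.\<close>

lemma monotone_fun_below_zero:
  assumes f: "monotone_fun n f" and s: "s \<in> strings n" "s \<noteq> zero_string n"
    and le: "string_le n (out_indices n f) s (zero_string n)"
  shows "f s = 0"
proof -
  obtain i where i: "i < n" "s ! i \<noteq> 0"
    using s by (auto simp: eq_zero_string_iff)
  have i1: "s ! i = 1"
    using nth_strings[OF s(1) i(1)] i(2) by simp
  have iO: "i \<notin> out_indices n f"
  proof
    assume "i \<in> out_indices n f"
    then have "s ! i \<le> zero_string n ! i"
      using le i(1) unfolding string_le_def by blast
    with i1 i(1) show False
      by simp
  qed
  \<comment> \<open>Replacing the zero string by the unit string changes only position
    \<open>i\<close>, which is not an output index; there the order asks for
    \<open>s ! i \<ge> 1\<close>.\<close>
  have "string_le n (out_indices n f) s (unit_string n i)"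
    using le iO i1 by (simp add: string_le_def)
  moreover have "f (unit_string n i) \<noteq> 1"
    using iO i(1) by (auto simp: out_indices_def)
  ultimately have "f s \<noteq> 1"
    using monotone_funD[OF f s(1) unit_string_in_strings] by blast
  then show ?thesis
    using bool_funsD(3)[of f n s] f s(1) unfolding monotone_fun_def by blast
qed

section \<open>Monotone functions are subtypes\<close>

lemma in_indices_eq:
  assumes "f \<in> bool_funs n"
  shows "in_indices n f = {..<n} - out_indices n f"
proof -
  have "f (unit_string n i) = 0 \<longleftrightarrow> f (unit_string n i) \<noteq> 1" for i
    using bool_funsD(3)[OF assms unit_string_in_strings[of n i]] by auto
  then show ?thesis
    by (auto simp: in_indices_def out_indices_def)
qed

lemma face_fun_strings:
  assumes "s \<in> strings n" "T \<subseteq> {..<n}"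
  shows "face_fun n T s = (if \<forall>i\<in>T. s ! i = 0 then 1 else 0)"
proof (cases "\<forall>i\<in>T. s ! i = 0")
  case True
  then show ?thesis
    using assms(1) by (simp add: face_fun_def)
next
  case False
  then obtain i where "i \<in> T" "s ! i \<noteq> 0"
    by blast
  then have "\<exists>i\<in>T. 1 - s ! i = 0"
    using nth_strings[OF assms(1), of i] assms(2) by (intro bexI[of _ i]) auto
  \<comment> \<open>Finiteness matters because a product over an infinite set is 1 by
    default.\<close>
  moreover have "finite T"
    using assms(2) finite_subset by blast
  ultimately have "(\<Prod>i\<in>T. 1 - s ! i) = 0"
    by (subst prod_zero_iff)
  then show ?thesis
    using assms(1) False by (auto simp: face_fun_def)
qed

lemma dual_strings:
  "s \<in> strings n \<Longrightarrow> dual n f s = (if s = zero_string n then 2 - f s else 1 - f s)"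
  by (simp add: dual_def point_fun_def)

lemma monotone_fun_imp_subtype:
  assumes f: "monotone_fun n f"
  shows "subtype n f"
proof -
  have fb: "f \<in> bool_funs n"
    using f by (simp add: monotone_fun_def)
  have "face_fun n (in_indices n f) s \<le> f s \<and> f s \<le> dual n (face_fun n (out_indices n f)) s" for s
  proof (cases "s \<in> strings n")
    \<comment> \<open>Off \<open>strings n\<close> all three functions are \<open>undefined\<close>,
      so both inequalities are equalities.\<close>
    case False
    then show ?thesis
      using extensional_arb[OF bool_funsD(1)[OF fb] False] by (simp add: face_fun_def dual_def)
  next
    case True
    \<comment> \<open>At a nonzero string the upper bound is 0 exactly when the string vanishes on
      the output indices, so this is the only case where it restricts \<open>f\<close>.\<close>
    have 0: "f s = 0" if "\<forall>i\<in>out_indices n f. s ! i = 0" "s \<noteq> zero_string n"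
    proof (rule monotone_fun_below_zero[OF f True that(2)])
      show "string_le n (out_indices n f) s (zero_string n)"
        using that(1) nth_strings[OF True] by (fastforce simp: string_le_def)
    qed
    have "(\<forall>i\<in>in_indices n f. s ! i = 0) \<longrightarrow> f s = 1"
    proof (intro impI, rule monotone_fun_above_zero[OF f True])
      assume "\<forall>i\<in>in_indices n f. s ! i = 0"
      then show "string_le n (out_indices n f) (zero_string n) s"
        using nth_strings[OF True] by (fastforce simp: string_le_def in_indices_eq[OF fb])
    qed
    moreover have "face_fun n (in_indices n f) s = (if \<forall>i\<in>in_indices n f. s ! i = 0 then 1 else 0)"
      by (rule face_fun_strings[OF True]) (auto simp: in_indices_def)
    ultimately have "face_fun n (in_indices n f) s \<le> f s"
      using bool_funsD(3)[OF fb True] by auto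
    moreover have "f s \<le> dual n (face_fun n (out_indices n f)) s"
    proof (cases "s = zero_string n")
      \<comment> \<open>The face function is 1 at the zero string, and the point function in
        \<open>dual\<close> lifts the bound to 2 - 1 = 1.\<close>
      case True
      then show ?thesis
        using out_indices_subset[of n f]
        by (auto simp: dual_strings face_fun_strings bool_funsD(2)[OF fb])
    next
      case False
      then show ?thesis
        using 0 bool_funsD(3)[OF fb True]
        by (auto simp: dual_strings[OF True] face_fun_strings[OF True out_indices_subset])
    qed
    ultimately show ?thesis ..
  qed
  then show ?thesis
    using fb by (auto simp: subtype_def le_fun_def)
qed

text \<open>Reduces every closure claim for monotone subtypes to monotonicity alone.\<close>

lemma monotone_subtype_iff: "monotone_subtype n f \<longleftrightarrow> monotone_fun n f"
  using monotone_fun_imp_subtype by (auto simp: monotone_subtype_def)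

section \<open>Pointwise maximum and minimum\<close>

lemma monotone_fun_sup_inf:
  assumes f: "monotone_fun n f" and g: "monotone_fun n g"
    and eq: "out_indices n f = out_indices n g"
  shows "monotone_fun n (sup f g)" "monotone_fun n (inf f g)"
proof -
  have fb: "f \<in> bool_funs n" and gb: "g \<in> bool_funs n"
    using f g by (simp_all add: monotone_fun_def)
  note vals = bool_funsD(3)[OF fb] bool_funsD(3)[OF gb]
  \<comment> \<open>Equal output indices mean that \<open>f\<close> and \<open>g\<close> agree on
    unit strings, so maximum and minimum keep the same output indices and all four functions are
    compared in one order.\<close>
  have unit_iff: "f (unit_string n i) = 1 \<longleftrightarrow> g (unit_string n i) = 1" if "i < n" for i
    using eq that by (auto simp: out_indices_def)
  have sup1: "sup f g s = 1 \<longleftrightarrow> f s = 1 \<or> g s = 1"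
    and inf1: "inf f g s = 1 \<longleftrightarrow> f s = 1 \<and> g s = 1" if "s \<in> strings n" for s
    using vals[OF that] by (auto simp: sup_int_def inf_int_def)
  have mono: "f s' = 1" if "f s = 1" "s \<in> strings n" "s' \<in> strings n"
      "string_le n (out_indices n f) s s'" for s s'
    using monotone_funD[OF f] that by blast
  have mono': "g s' = 1" if "g s = 1" "s \<in> strings n" "s' \<in> strings n"
      "string_le n (out_indices n f) s s'" for s s'
    using monotone_funD[OF g] that eq by auto
  have "sup f g \<in> bool_funs n"
  proof (rule bool_funsI)
    show "sup f g \<in> extensional (strings n)"
      using bool_funsD(1)[OF fb] bool_funsD(1)[OF gb] by (simp add: extensional_def)
    show "sup f g s = 0 \<or> sup f g s = 1" if "s \<in> strings n" for s
      using vals[OF that] by (auto simp: sup_int_def)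
  qed (simp add: bool_funsD(2)[OF fb] bool_funsD(2)[OF gb])
  moreover have "out_indices n (sup f g) = out_indices n f"
    \<comment> \<open>Unfolding by \<open>sup_apply\<close> would destroy the pattern
      \<open>sup f g s\<close> that \<open>sup1\<close> rewrites.\<close>
    using unit_iff by (auto simp: out_indices_def sup1 simp del: sup_apply)
  ultimately show "monotone_fun n (sup f g)"
    by (rule monotone_funI) (use mono mono' in \<open>auto simp: sup1 simp del: sup_apply\<close>)
  have "inf f g \<in> bool_funs n"
  proof (rule bool_funsI)
    show "inf f g \<in> extensional (strings n)"
      using bool_funsD(1)[OF fb] bool_funsD(1)[OF gb] by (simp add: extensional_def)
    show "inf f g s = 0 \<or> inf f g s = 1" if "s \<in> strings n" for s
      using vals[OF that] by (auto simp: inf_int_def)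
  qed (simp add: bool_funsD(2)[OF fb] bool_funsD(2)[OF gb])
  moreover have "out_indices n (inf f g) = out_indices n f"
    using unit_iff by (auto simp: out_indices_def inf1 simp del: inf_apply)
  ultimately show "monotone_fun n (inf f g)"
    by (rule monotone_funI) (use mono mono' in \<open>auto simp: inf1 simp del: inf_apply\<close>)
qed

section \<open>Duality\<close>

lemma string_le_Compl: "string_le n ({..<n} - A) s s' \<longleftrightarrow> string_le n A s' s"
  by (auto simp: string_le_def)

text \<open>Away from the zero string, the dual reverses values and, by exchanging inputs with
  outputs, also the order. If the larger string is zero, the dual is 1 there. If only the smaller
  one is zero, the other lies below zero in the order of \<open>f\<close>, which forces
  \<open>f\<close> to vanish on it.\<close>

lemma monotone_fun_dual:
  assumes f: "monotone_fun n f"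
  shows "monotone_fun n (dual n f)"
proof (rule monotone_funI)
  have fb: "f \<in> bool_funs n"
    using f by (simp add: monotone_fun_def)
  show "dual n f \<in> bool_funs n"
  proof (rule bool_funsI)
    show "dual n f \<in> extensional (strings n)"
      by (simp add: dual_def)
    show "dual n f (zero_string n) = 1"
      by (simp add: dual_strings bool_funsD(2)[OF fb])
    show "dual n f s = 0 \<or> dual n f s = 1" if "s \<in> strings n" for s
      using bool_funsD(3)[OF fb that] bool_funsD(2)[OF fb] by (auto simp: dual_strings that)
  qed
  have "out_indices n (dual n f) = in_indices n f"
    by (auto simp: out_indices_def in_indices_def dual_strings unit_string_neq_zero_string)
  then show "out_indices n (dual n f) = {..<n} - out_indices n f"
    by (simp add: in_indices_eq[OF fb])
  fix s s' assume s: "s \<in> strings n" "s' \<in> strings n"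
    and "string_le n ({..<n} - out_indices n f) s s'" and 1: "dual n f s = 1"
  then have le: "string_le n (out_indices n f) s' s"
    by (simp add: string_le_Compl)
  show "dual n f s' = 1"
  proof (cases "s' = zero_string n")
    case True
    then show ?thesis
      by (simp add: dual_strings bool_funsD(2)[OF fb])
  next
    case False
    have "f s' = 0"
    proof (cases "s = zero_string n")
      case True
      with monotone_fun_below_zero[OF f s(2) False] le show ?thesis
        by simp
    next
      case False
      then have "f s \<noteq> 1"
        using 1 s by (simp add: dual_strings)
      then show ?thesis
        using monotone_funD[OF f s(2,1) le] bool_funsD(3)[OF fb s(2)] by auto
    qed
    with False s show ?thesis
      by (simp add: dual_strings)
  qed
qed

section \<open>Permutations of positions\<close>

lemma perm_string_in_strings:
  assumes "\<sigma> permutes {..<n}" "s \<in> strings n"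
  shows "perm_string \<sigma> s \<in> strings n"
  using permutes_inv[OF assms(1)] assms(2) set_permute_list[of "inv \<sigma>" s]
  by (auto simp: strings_def perm_string_def)

lemma nth_perm_string:
  assumes "\<sigma> permutes {..<n}" "s \<in> strings n" "i < n"
  shows "perm_string \<sigma> s ! i = s ! inv \<sigma> i"
  using permutes_inv[OF assms(1)] assms(2,3)
  by (simp add: perm_string_def permute_list_nth length_strings)

text \<open>Entry \<open>j\<close> of the image is 1 iff \<open>inv \<sigma> j = i\<close>, that is,
  iff \<open>j = \<sigma> i\<close>. Hence the output indices of the composed function are the
  preimage under \<open>\<sigma>\<close> of those of \<open>f\<close>.\<close>

lemma perm_string_unit_string:
  assumes "\<sigma> permutes {..<n}"
  shows "perm_string \<sigma> (unit_string n i) = unit_string n (\<sigma> i)"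
proof (rule nth_equalityI)
  note p = perm_string_in_strings[OF assms unit_string_in_strings[of n i]]
  show "length (perm_string \<sigma> (unit_string n i)) = length (unit_string n (\<sigma> i))"
    using length_strings[OF p] by (simp add: unit_string_def)
  fix j assume "j < length (perm_string \<sigma> (unit_string n i))"
  then have j: "j < n"
    using length_strings[OF p] by simp
  moreover have "inv \<sigma> j < n"
    using permutes_in_image[OF permutes_inv[OF assms], of j] j by simp
  ultimately show "perm_string \<sigma> (unit_string n i) ! j = unit_string n (\<sigma> i) ! j"
    using permutes_inv_eq[OF assms, of j i] by (auto simp: nth_perm_string[OF assms])
qed

lemma monotone_fun_perm_fun:
  assumes f: "monotone_fun n f" and p: "\<sigma> permutes {..<n}"
  shows "monotone_fun n (perm_fun n f \<sigma>)"
proof (rule monotone_funI)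
  have fb: "f \<in> bool_funs n"
    using f by (simp add: monotone_fun_def)
  note ps = perm_string_in_strings[OF p]
  have val: "perm_fun n f \<sigma> s = f (perm_string \<sigma> s)" if "s \<in> strings n" for s
    using that by (simp add: perm_fun_def compose_eq)
  have inv_lt: "inv \<sigma> j < n \<longleftrightarrow> j < n" for j
    using permutes_in_image[OF permutes_inv[OF p], of j] by simp
  have lt: "\<sigma> j < n \<longleftrightarrow> j < n" for j
    using permutes_in_image[OF p, of j] by simp
  have "perm_string \<sigma> (zero_string n) = zero_string n"
    by (simp add: eq_zero_string_iff[OF ps] nth_perm_string[OF p] inv_lt)
  then show "perm_fun n f \<sigma> \<in> bool_funs n"
    using bool_funsD[OF fb] ps by (intro bool_funsI) (auto simp: perm_fun_def compose_eq)
  show "out_indices n (perm_fun n f \<sigma>) = {i. \<sigma> i \<in> out_indices n f}"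
    by (auto simp: out_indices_def val perm_string_unit_string[OF p] lt)
  fix s s' assume s: "s \<in> strings n" "s' \<in> strings n"
    and le: "string_le n {i. \<sigma> i \<in> out_indices n f} s s'" and 1: "perm_fun n f \<sigma> s = 1"
  \<comment> \<open>Position \<open>i\<close> here compares the original entries at
    \<open>inv \<sigma> i\<close>, which lies in the preimage set iff \<open>i\<close> is an output
    index of \<open>f\<close>.\<close>
  have "string_le n (out_indices n f) (perm_string \<sigma> s) (perm_string \<sigma> s')"
    using le s by (auto simp: string_le_def nth_perm_string[OF p] inv_lt permutes_inverses(1)[OF p])
  then show "perm_fun n f \<sigma> s' = 1"
    using monotone_funD[OF f ps[OF s(1)] ps[OF s(2)]] 1 s by (simp add: val)
qed

section \<open>Concatenated strings: tensor and causal product\<close>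

lemma string_le_append:
  assumes "A \<subseteq> {..<n}" "length s = n + m" "length s' = n + m"
    and le: "string_le (n + m) (A \<union> (+) n ` B) s s'"
  shows "string_le n A (take n s) (take n s')" "string_le m B (drop n s) (drop n s')"
proof -
  have "i \<in> A \<union> (+) n ` B \<longleftrightarrow> i \<in> A" if "i < n" for i
    using that by auto
  then show "string_le n A (take n s) (take n s')"
    using le by (auto simp: string_le_def)
  \<comment> \<open>The bound on \<open>A\<close> keeps it out of the second block, so there only
    the shifted copy of \<open>B\<close> decides the direction.\<close>
  have *: "n + i \<in> A \<union> (+) n ` B \<longleftrightarrow> i \<in> B" for i
    using assms(1) by auto
  show "string_le m B (drop n s) (drop n s')"
    unfolding string_le_def
  proof (intro conjI ballI)
    fix i assume "i \<in> {..<m} \<inter> B"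
    then show "drop n s ! i \<le> drop n s' ! i"
      using le * [of i] assms(2,3) by (auto simp: string_le_def)
  next
    fix i assume "i \<in> {..<m} - B"
    then have "n + i \<in> {..<n + m} - (A \<union> (+) n ` B)"
      using * [of i] by simp
    then show "drop n s' ! i \<le> drop n s ! i"
      using le assms(2,3) unfolding string_le_def by auto
  qed
qed

text \<open>Common to both products: a unit string of length \<open>n + m\<close> is a unit string
  in one block and zero in the other, and each product then takes the value of the factor on the
  nonzero block.\<close>

lemma out_indices_append:
  assumes "\<And>i. i < n \<Longrightarrow> h (unit_string (n + m) i) = f (unit_string n i)"
    and "\<And>i. i < m \<Longrightarrow> h (unit_string (n + m) (n + i)) = g (unit_string m i)"
  shows "out_indices (n + m) h = out_indices n f \<union> (+) n ` out_indices m g"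
proof (intro set_eqI iffI)
  fix i assume i: "i \<in> out_indices (n + m) h"
  show "i \<in> out_indices n f \<union> (+) n ` out_indices m g"
  proof (cases "i < n")
    case True
    with i assms(1)[of i] show ?thesis
      by (simp add: out_indices_def)
  next
    case False
    with i assms(2)[of "i - n"] have "i - n \<in> out_indices m g"
      by (auto simp: out_indices_def)
    then have "n + (i - n) \<in> (+) n ` out_indices m g"
      by blast
    with False show ?thesis
      by simp
  qed
qed (use assms in \<open>auto simp: out_indices_def\<close>)

text \<open>A product of values in {0, 1} is 1 iff both factors are 1, and the order splits into the
  orders of the two blocks.\<close>

lemma monotone_fun_tensor:
  assumes f: "monotone_fun n f" and g: "monotone_fun m g"
  shows "monotone_fun (n + m) (tensor n m f g)"
proof (rule monotone_funI)
  have fb: "f \<in> bool_funs n" and gb: "g \<in> bool_funs m"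
    using f g by (simp_all add: monotone_fun_def)
  have val: "tensor n m f g s = f (take n s) * g (drop n s)" if "s \<in> strings (n + m)" for s
    using that by (simp add: tensor_def)
  show "tensor n m f g \<in> bool_funs (n + m)"
  proof (rule bool_funsI)
    show "tensor n m f g \<in> extensional (strings (n + m))"
      by (simp add: tensor_def)
    show "tensor n m f g s = 0 \<or> tensor n m f g s = 1" if "s \<in> strings (n + m)" for s
      using bool_funsD(3)[OF fb take_in_strings[OF that]] bool_funsD(3)[OF gb drop_in_strings[OF that]]
      by (auto simp: val that)
  qed (simp add: val bool_funsD(2)[OF fb] bool_funsD(2)[OF gb])
  show "out_indices (n + m) (tensor n m f g) = out_indices n f \<union> (+) n ` out_indices m g"
    by (rule out_indices_append)
       (simp_all add: val take_unit_string drop_unit_string bool_funsD(2)[OF fb] bool_funsD(2)[OF gb])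
  fix s s' assume s: "s \<in> strings (n + m)" "s' \<in> strings (n + m)"
    and le: "string_le (n + m) (out_indices n f \<union> (+) n ` out_indices m g) s s'"
    and 1: "tensor n m f g s = 1"
  note t = take_in_strings[OF s(1)] take_in_strings[OF s(2)]
  note d = drop_in_strings[OF s(1)] drop_in_strings[OF s(2)]
  note le' = string_le_append[OF out_indices_subset length_strings[OF s(1)] length_strings[OF s(2)] le]
  have "f (take n s) = 1" "g (drop n s) = 1"
    using 1 s bool_funsD(3)[OF fb t(1)] bool_funsD(3)[OF gb d(1)] by (auto simp: val)
  then have "f (take n s') = 1" "g (drop n s') = 1"
    using monotone_funD[OF f t le'(1)] monotone_funD[OF g d le'(2)] by auto
  then show "tensor n m f g s' = 1"
    using s by (simp add: val)
qed

text \<open>If both first blocks are zero, \<open>g\<close> decides; if both are nonzero,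
  \<open>f\<close> does. The changes of formula are handled by the comparisons with the zero
  string.\<close>

lemma monotone_fun_causal:
  assumes f: "monotone_fun n f" and g: "monotone_fun m g"
  shows "monotone_fun (n + m) (causal n m f g)"
proof (rule monotone_funI)
  have fb: "f \<in> bool_funs n" and gb: "g \<in> bool_funs m"
    using f g by (simp_all add: monotone_fun_def)
  have val: "causal n m f g s = (if take n s = zero_string n then g (drop n s) else f (take n s))"
    if "s \<in> strings (n + m)" for s
    using that by (simp add: causal_def)
  show "causal n m f g \<in> bool_funs (n + m)"
  proof (rule bool_funsI)
    show "causal n m f g \<in> extensional (strings (n + m))"
      by (simp add: causal_def)
    show "causal n m f g s = 0 \<or> causal n m f g s = 1" if "s \<in> strings (n + m)" for s
      using bool_funsD(3)[OF fb take_in_strings[OF that]] bool_funsD(3)[OF gb drop_in_strings[OF that]]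
      by (auto simp: val that)
  qed (simp add: val bool_funsD(2)[OF gb])
  show "out_indices (n + m) (causal n m f g) = out_indices n f \<union> (+) n ` out_indices m g"
    by (rule out_indices_append)
       (simp_all add: val take_unit_string drop_unit_string unit_string_neq_zero_string)
  fix s s' assume s: "s \<in> strings (n + m)" "s' \<in> strings (n + m)"
    and le: "string_le (n + m) (out_indices n f \<union> (+) n ` out_indices m g) s s'"
    and 1: "causal n m f g s = 1"
  note t = take_in_strings[OF s(1)] take_in_strings[OF s(2)]
  note d = drop_in_strings[OF s(1)] drop_in_strings[OF s(2)]
  note le' = string_le_append[OF out_indices_subset length_strings[OF s(1)] length_strings[OF s(2)] le]
  show "causal n m f g s' = 1"
  proof (cases "take n s = zero_string n")
    case z: True
    show ?thesis
    proof (cases "take n s' = zero_string n")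
      case True
      then show ?thesis
        using monotone_funD[OF g d le'(2)] z 1 s by (simp add: val)
    next
      \<comment> \<open>The first block moves up from zero, so \<open>f\<close> is 1 on it whatever
        \<open>g\<close> gave before.\<close>
      case False
      then show ?thesis
        using monotone_fun_above_zero[OF f t(2)] le'(1) z s by (simp add: val)
    qed
  next
    case z: False
    then have f1: "f (take n s) = 1"
      using 1 s by (simp add: val)
    \<comment> \<open>A nonzero block below zero would have \<open>f\<close>-value 0, contradicting
      \<open>f1\<close>; so the formula cannot switch to \<open>g\<close>.\<close>
    then have "take n s' \<noteq> zero_string n"
      using monotone_fun_below_zero[OF f t(1) z] le'(1) by auto
    then show ?thesis
      using monotone_funD[OF f t le'(1) f1] s by (simp add: val)
  qed
qed

section \<open>Type functions and the collected statement\<close>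

lemma monotone_fun_one_fun: "monotone_fun n (one_fun n)"
  by (rule monotone_funI[OF bool_funsI refl]) (simp_all add: one_fun_def)

lemma type_fun_imp_monotone_fun: "type_fun n f \<Longrightarrow> monotone_fun n f"
  \<comment> \<open>Each introduction rule has its closure lemma; the base instance is simplified
    because \<open>1\<close> is rewritten to \<open>Suc 0\<close> in the goal.\<close>
  by (induction rule: type_fun.induct)
     (simp_all add: monotone_fun_one_fun[of 1, simplified] monotone_fun_dual
       monotone_fun_perm_fun monotone_fun_tensor)

theorem lemma4p5:
  shows
    "(\<forall>n f g. monotone_subtype n f \<and> monotone_subtype n g \<and> out_indices n f = out_indices n g \<longrightarrow>
        monotone_fun n (sup f g) \<and> monotone_fun n (inf f g)) \<and>
     (\<forall>n m f g \<sigma>. monotone_subtype n f \<and> monotone_subtype m g \<and> \<sigma> permutes {..<n} \<longrightarrow>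
        monotone_subtype n (perm_fun n f \<sigma>) \<and>
        monotone_subtype n (dual n f) \<and>
        monotone_subtype (n + m) (causal n m f g) \<and>
        monotone_subtype (n + m) (tensor n m f g) \<and>
        monotone_subtype (n + m) (dual (n + m) (tensor n m (dual n f) (dual m g)))) \<and>
     (\<forall>n f. type_fun n f \<longrightarrow> monotone_fun n f)"
  \<comment> \<open>Only monotonicity remains; the last function in the second group is covered by
    chaining the dual and tensor lemmas.\<close>
  unfolding monotone_subtype_iff
  by (intro conjI allI impI)
     (auto intro: monotone_fun_sup_inf monotone_fun_perm_fun monotone_fun_dual
        monotone_fun_causal monotone_fun_tensor type_fun_imp_monotone_fun)

end
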